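(* Let $P$ be a weakly ranked, finite, bounded poset of weak rank at most $6$. Then the coefficient sequence of its Chow polynomial $H_P(t)$ is log-concave, i.e. writing $H_P(t)=\sum_{i=0}^{d}h_it^i$, one has $h_i^2\ge h_{i-1}h_{i+1}$ for all $1\le i\le d-1$.
   Context: A weak rank function on a poset $P$ is a function $\rho:P\times P\to\mathbb{N}$, $(x,y)\mapsto\rho_{x,y}$, with $\rho_{x,y}>0$ iff $x<y$ and $\rho_{x,y}=\rho_{x,z}+\rho_{z,y}$ for $x\le z\le y$; $P$ is bounded with least element $\hat0$, greatest element $\hat1$, $\rho(x)=\rho_{\hat0,x}$, and the weak rank of $P$ is $\rho(\hat1)$. The Chow polynomial is $$H_P(t)=\sum_{s\ge 0}\ \sum_{\hat0=p_0<p_1<\cdots<p_s\le \hat1}\ \prod_{i=1}^{s}\frac{t\left(t^{\rho(p_i)-\rho(p_{i-1})-1}-1\right)}{t-1}.$$ *)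

theory Defs
  imports "HOL-Computational_Algebra.Polynomial"
begin

text \<open>
  A poset is a carrier \<open>P\<close> together with its order relation \<open>r\<close>, subject to
  \<open>partial_order_on P r\<close>; here \<open>(x, y) \<in> r\<close> means \<open>x \<le> y\<close>.
\<close>

definition less_in :: "'a rel \<Rightarrow> 'a \<Rightarrow> 'a \<Rightarrow> bool" where
  "less_in r x y \<longleftrightarrow> (x, y) \<in> r \<and> x \<noteq> y"

definition least_in :: "'a set \<Rightarrow> 'a rel \<Rightarrow> 'a \<Rightarrow> bool" where
  "least_in P r a \<longleftrightarrow> a \<in> P \<and> (\<forall>x\<in>P. (a, x) \<in> r)"

definition greatest_in :: "'a set \<Rightarrow> 'a rel \<Rightarrow> 'a \<Rightarrow> bool" where
  "greatest_in P r b \<longleftrightarrow> b \<in> P \<and> (\<forall>x\<in>P. (x, b) \<in> r)"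

text \<open>The first conjunct forces \<open>\<rho> x y = 0\<close> for every pair in \<open>P \<times> P\<close> with not \<open>x < y\<close>.\<close>

definition weak_rank_function :: "'a set \<Rightarrow> 'a rel \<Rightarrow> ('a \<Rightarrow> 'a \<Rightarrow> nat) \<Rightarrow> bool" where
  "weak_rank_function P r \<rho> \<longleftrightarrow>
     (\<forall>x\<in>P. \<forall>y\<in>P. \<rho> x y > 0 \<longleftrightarrow> less_in r x y) \<and>
     (\<forall>x\<in>P. \<forall>y\<in>P. \<forall>z\<in>P. (x, z) \<in> r \<and> (z, y) \<in> r \<longrightarrow> \<rho> x y = \<rho> x z + \<rho> z y)"

text \<open>
  The list \<open>[p\<^sub>0, \<dots>, p\<^sub>s]\<close> encodes the chain \<open>a = p\<^sub>0 < \<dots> < p\<^sub>s \<le> b\<close>; \<open>p\<^sub>s = b\<close> is allowed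
  and \<open>s = 0\<close> is the one-element list.
\<close>

definition chains_from_to :: "'a set \<Rightarrow> 'a rel \<Rightarrow> 'a \<Rightarrow> 'a \<Rightarrow> 'a list set" where
  "chains_from_to P r a b =
     {ps. ps \<noteq> [] \<and> set ps \<subseteq> P \<and> hd ps = a \<and> sorted_wrt (less_in r) ps \<and> (last ps, b) \<in> r}"

text \<open>
  The factor \<open>t (t\<^bsup>k-1\<^esup> - 1) / (t - 1)\<close>, where \<open>t\<close> is \<open>[:0, 1:]\<close>. The division is exact;
  see \<open>chow_factor_exact\<close> and \<open>chow_factor_eq_sum\<close>. It is only used for \<open>k \<ge> 1\<close>.
\<close>

definition chow_factor :: "nat \<Rightarrow> int poly" where
  "chow_factor k = ([:0, 1:] * ([:0, 1:] ^ (k - 1) - 1)) div ([:0, 1:] - 1)"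

text \<open>
  Summing over all lists in \<open>chains_from_to\<close> merges the sum over \<open>s\<close> with the sum over chains
  of length \<open>s\<close>. By additivity \<open>\<rho> a\<close> is strictly increasing along a chain, so the subtraction
  on naturals does not truncate.
\<close>

definition chow_poly :: "'a set \<Rightarrow> 'a rel \<Rightarrow> ('a \<Rightarrow> 'a \<Rightarrow> nat) \<Rightarrow> 'a \<Rightarrow> 'a \<Rightarrow> int poly" where
  "chow_poly P r \<rho> a b =
     (\<Sum>ps\<in>chains_from_to P r a b.
        \<Prod>i = 1..length ps - 1. chow_factor (\<rho> a (ps ! i) - \<rho> a (ps ! (i - 1))))"

lemma chow_factor_eq_sum: "chow_factor k = (\<Sum>j = 1..<k. [:0, 1:] ^ j)"
proof -
  let ?t = "[:0, 1:] :: int poly"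
  have s: "(\<Sum>j = 1..<k. ?t ^ j) = ?t * (\<Sum>j<k - 1. ?t ^ j)"
  proof (cases k)
    case (Suc n)
    show ?thesis
      unfolding Suc by (simp only: sum.atLeast_Suc_lessThan_Suc_shift sum_distrib_left
          lessThan_atLeast0 One_nat_def o_def power_Suc diff_Suc_Suc minus_nat.diff_0)
  qed simp
  have "?t * (?t ^ (k - 1) - 1) = (\<Sum>j = 1..<k. ?t ^ j) * (?t - 1)"
    unfolding s by (simp only: power_diff_1_eq mult_ac)
  moreover have "?t - 1 \<noteq> 0" by (simp add: one_pCons)
  ultimately show ?thesis
    unfolding chow_factor_def by (metis nonzero_mult_div_cancel_right)
qed

lemma chow_factor_exact: "chow_factor k * ([:0, 1:] - 1) = [:0, 1:] * ([:0, 1:] ^ (k - 1) - 1)"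
proof -
  let ?t = "[:0, 1:] :: int poly"
  have "?t - 1 dvd ?t ^ (k - 1) - 1"
    by (simp only: power_diff_1_eq dvd_triv_left)
  then have "?t - 1 dvd ?t * (?t ^ (k - 1) - 1)"
    by (rule dvd_mult)
  then show ?thesis
    unfolding chow_factor_def by (rule dvd_div_mult_self)
qed

lemma finite_chains_from_to:
  assumes "finite P"
  shows "finite (chains_from_to P r a b)"
proof -
  have "distinct ps" if "sorted_wrt (less_in r) ps" for ps
    using that by (induction ps) (auto simp: less_in_def)
  then have "chains_from_to P r a b \<subseteq> {ps. set ps \<subseteq> P \<and> distinct ps}"
    by (auto simp: chains_from_to_def)
  then show ?thesis
    using finite_subset_distinct[OF assms] finite_subset by blast
qed

end

theory Submission
  imports Defs
begin

text \<open>
  Splitting a chain after its first step gives \<open>H\<^sub>x = 1 + (\<Sum>y>x. f\<^bsub>\<rho>(x,y)\<^esub> H\<^sub>y)\<close>, where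
  \<open>f\<^sub>k = t + \<dots> + t\<^bsup>k-1\<^esup>\<close> and \<open>H\<^sub>x\<close> is the Chow polynomial of the interval above \<open>x\<close>.
  As \<open>f\<^sub>k\<close> is symmetric about \<open>k/2\<close>, induction shows that \<open>H\<close> is symmetric about \<open>(d-1)/2\<close>, where
  \<open>d\<close> is the weak rank. The recursion also gives \<open>h\<^sub>0 = 1\<close>, \<open>h\<^sub>2 \<le> h\<^sub>1\<^sup>2\<close>, and \<open>h\<^sub>1 \<le> h\<^sub>2\<close> if
  \<open>d \<ge> 4\<close>. For \<open>d \<le> 6\<close> symmetry reduces every instance of log-concavity to these inequalities.
\<close>

section \<open>Polynomials with symmetric coefficients\<close>

definition symmetric_poly :: "nat \<Rightarrow> 'a::zero poly \<Rightarrow> bool" where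
  "symmetric_poly n p \<longleftrightarrow> degree p \<le> n \<and> (\<forall>i\<le>n. coeff p i = coeff p (n - i))"

text \<open>The right-hand side is t^n p(1/t). Since \<open>reflect_poly\<close> is multiplicative,
  closure under products becomes a computation with monomials.\<close>

lemma symmetric_poly_iff_reflect_poly:
  fixes p :: "'a::comm_semiring_1 poly"
  shows "symmetric_poly n p \<longleftrightarrow> degree p \<le> n \<and> p = monom 1 (n - degree p) * reflect_poly p"
proof (cases "degree p \<le> n")
  case True
  have "coeff (monom 1 (n - degree p) * reflect_poly p) i = (if i \<le> n then coeff p (n - i) else 0)"
    for i
    using True by (auto simp: coeff_monom_mult coeff_reflect_poly coeff_eq_0)
  with True show ?thesis
    unfolding symmetric_poly_def poly_eq_iff by (auto simp: coeff_eq_0)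
qed (simp add: symmetric_poly_def)

lemma symmetric_poly_mult:
  fixes p q :: "'a::idom poly"
  assumes "symmetric_poly m p" "symmetric_poly n q"
  shows "symmetric_poly (m + n) (p * q)"
proof (cases "p = 0 \<or> q = 0")
  case False
  have p: "degree p \<le> m" "p = monom 1 (m - degree p) * reflect_poly p"
    and q: "degree q \<le> n" "q = monom 1 (n - degree q) * reflect_poly q"
    using assms by (auto simp: symmetric_poly_iff_reflect_poly)
  have deg: "degree (p * q) = degree p + degree q"
    using False by (simp add: degree_mult_eq)
  have "p * q = (monom 1 (m - degree p) * reflect_poly p) *
      (monom 1 (n - degree q) * reflect_poly q)"
    by (rule arg_cong2[of _ _ _ _ times, OF p(2) q(2)])
  also have "\<dots> = (monom 1 (m - degree p) * monom 1 (n - degree q)) * reflect_poly (p * q)"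
    by (simp only: reflect_poly_mult mult_ac)
  also have "monom 1 (m - degree p) * monom 1 (n - degree q) =
      (monom 1 (m + n - degree (p * q)) :: 'a poly)"
    using p(1) q(1) by (simp add: mult_monom deg)
  finally show ?thesis
    using p(1) q(1) deg by (simp add: symmetric_poly_iff_reflect_poly)
qed (auto simp: symmetric_poly_def)

lemma symmetric_poly_add:
  assumes "symmetric_poly n p" "symmetric_poly n q"
  shows "symmetric_poly n (p + q)"
  using assms unfolding symmetric_poly_def by (metis coeff_add degree_add_le)

lemma symmetric_poly_sum:
  assumes "\<And>x. x \<in> A \<Longrightarrow> symmetric_poly n (f x)"
  shows "symmetric_poly n (\<Sum>x\<in>A. f x)"
  using assms
  by (induction A rule: infinite_finite_induct)
    (auto intro: symmetric_poly_add simp: symmetric_poly_def[of _ 0])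

section \<open>The factors of a chain weight\<close>

lemma coeff_chow_factor: "coeff (chow_factor k) i = (if 1 \<le> i \<and> i < k then 1 else 0)"
  by (simp add: chow_factor_eq_sum coeff_sum monom_altdef[of "1::int", symmetric, unfolded smult_1_left])

lemma symmetric_chow_factor: "symmetric_poly k (chow_factor k)"
  unfolding symmetric_poly_def
  by (auto simp: coeff_chow_factor intro!: degree_le)

text \<open>Adding the constant term moves the centre from k/2 to (k-1)/2, the centre needed for the
  Chow polynomial. This handles the summand of the top element in the recursion.\<close>

lemma symmetric_one_plus_chow_factor: "symmetric_poly (k - 1) (1 + chow_factor k)"
  unfolding symmetric_poly_def
  by (auto simp: coeff_chow_factor intro!: degree_le)

section \<open>Intervals with fixed top \<open>b\<close> and varying lower end\<close>

locale weakly_ranked_poset =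
  fixes P :: "'a set" and r :: "'a rel" and \<rho> :: "'a \<Rightarrow> 'a \<Rightarrow> nat" and b :: 'a
  assumes finite: "finite P"
    and po: "partial_order_on P r"
    and greatest: "greatest_in P r b"
    and weak_rank: "weak_rank_function P r \<rho>"
begin

abbreviation H :: "'a \<Rightarrow> int poly" where
  "H x \<equiv> chow_poly P r \<rho> x b"

definition above :: "'a \<Rightarrow> 'a set" where
  "above x = {y \<in> P. less_in r x y}"

text \<open>Since \<open>chow_factor 1 = 0\<close>, these are the elements above \<open>x\<close>
  that contribute to the recursion.\<close>

definition above2 :: "'a \<Rightarrow> 'a set" where
  "above2 x = {y \<in> P. \<rho> x y \<ge> 2}"

lemma finite_above [simp]: "finite (above x)" and finite_above2 [simp]: "finite (above2 x)"
  using finite by (auto simp: above_def above2_def)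

lemma top: "b \<in> P" "x \<in> P \<Longrightarrow> (x, b) \<in> r"
  using greatest by (auto simp: greatest_in_def)

lemma less_trans: "less_in r x y \<Longrightarrow> less_in r y z \<Longrightarrow> less_in r x z"
  using po unfolding partial_order_on_def preorder_on_def less_in_def
  by (metis antisymD transD)

lemma rank_pos: "x \<in> P \<Longrightarrow> y \<in> P \<Longrightarrow> \<rho> x y > 0 \<longleftrightarrow> less_in r x y"
  using weak_rank by (auto simp: weak_rank_function_def)

lemma rank_add:
  "x \<in> P \<Longrightarrow> y \<in> P \<Longrightarrow> z \<in> P \<Longrightarrow> (x, y) \<in> r \<Longrightarrow> (y, z) \<in> r \<Longrightarrow> \<rho> x z = \<rho> x y + \<rho> y z"
  using weak_rank unfolding weak_rank_function_def by blast

lemma rank_self: "x \<in> P \<Longrightarrow> \<rho> x x = 0"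
  using rank_pos[of x x] by (auto simp: less_in_def)

section \<open>Recursion on the first step of a chain\<close>

lemma chains_eq:
  assumes "x \<in> P"
  shows "chains_from_to P r x b =
    insert [x] (\<Union>y\<in>above x. (#) x ` chains_from_to P r y b)" (is "?L = ?R")
proof (intro equalityI subsetI)
  fix ps assume ps: "ps \<in> ?L"
  then obtain qs where qs: "ps = x # qs"
    by (cases ps) (auto simp: chains_from_to_def)
  show "ps \<in> ?R"
  proof (cases qs)
    case (Cons y zs)
    then have "y \<in> above x" "qs \<in> chains_from_to P r y b"
      using ps qs by (auto simp: chains_from_to_def above_def)
    then show ?thesis using qs by blast
  qed (simp add: qs)
next
  fix ps assume "ps \<in> ?R"
  then consider "ps = [x]" | y qs where "y \<in> above x" "qs \<in> chains_from_to P r y b" "ps = x # qs"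
    by blast
  then show "ps \<in> ?L"
  proof cases
    case 1
    then show ?thesis using assms top(2) by (auto simp: chains_from_to_def)
  next
    case 2
    then obtain zs where "qs = y # zs"
      by (cases qs) (auto simp: chains_from_to_def)
    then show ?thesis using 2 assms
      by (auto simp: chains_from_to_def above_def intro: less_trans)
  qed
qed

text \<open>By additivity, changing the base point from \<open>x\<close> to \<open>y\<close> lowers
  every rank along \<open>qs\<close> by \<open>\<rho> x y\<close>, so the rank differences within
  \<open>qs\<close> are unchanged.\<close>

lemma chain_weight_Cons:
  assumes "x \<in> P" "y \<in> above x" "qs \<in> chains_from_to P r y b"
  shows "(\<Prod>i = 1..length (x # qs) - 1. chow_factor (\<rho> x ((x # qs) ! i) - \<rho> x ((x # qs) ! (i - 1))))
    = chow_factor (\<rho> x y) *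
      (\<Prod>i = 1..length qs - 1. chow_factor (\<rho> y (qs ! i) - \<rho> y (qs ! (i - 1))))"
proof -
  obtain zs where qs: "qs = y # zs"
    using assms(3) by (cases qs) (auto simp: chains_from_to_def)
  have y: "y \<in> P" "(x, y) \<in> r"
    using assms(2) by (auto simp: above_def less_in_def)
  have "\<rho> x z = \<rho> x y + \<rho> y z" if "z \<in> set qs" for z
  proof (cases "z = y")
    case True
    then show ?thesis using rank_self[OF y(1)] by simp
  next
    case False
    then have "z \<in> P" "(y, z) \<in> r"
      using that assms(3) by (auto simp: qs chains_from_to_def less_in_def)
    then show ?thesis using rank_add[OF assms(1) y(1)] y(2) by blast
  qed
  then have nth: "\<rho> x (qs ! i) = \<rho> x y + \<rho> y (qs ! i)" if "i < length qs" for i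
    using that by simp
  have "(\<Prod>i = 1..length (x # qs) - 1. chow_factor (\<rho> x ((x # qs) ! i) - \<rho> x ((x # qs) ! (i - 1))))
    = (\<Prod>i = 0..length zs. chow_factor (\<rho> x (qs ! i) - \<rho> x ((x # qs) ! i)))"
    using prod.shift_bounds_cl_Suc_ivl
      [of "\<lambda>i. chow_factor (\<rho> x ((x # qs) ! i) - \<rho> x ((x # qs) ! (i - 1)))" 0 "length zs"]
    by (simp add: qs)
  \<comment> \<open>The factor at index 0 is the step from \<open>x\<close> to \<open>y\<close>; its
    rank difference is \<open>\<rho> x y - \<rho> x x\<close>.\<close>
  also have "\<dots> = chow_factor (\<rho> x y) *
      (\<Prod>i = 1..length zs. chow_factor (\<rho> x (qs ! i) - \<rho> x ((x # qs) ! i)))"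
    by (subst prod.atLeast_Suc_atMost) (auto simp: qs rank_self assms(1))
  also have "(\<Prod>i = 1..length zs. chow_factor (\<rho> x (qs ! i) - \<rho> x ((x # qs) ! i))) =
      (\<Prod>i = 1..length qs - 1. chow_factor (\<rho> y (qs ! i) - \<rho> y (qs ! (i - 1))))"
  proof (rule prod.cong)
    fix i assume "i \<in> {1..length qs - 1}"
    then have "i < length qs" "i - 1 < length qs" "(x # qs) ! i = qs ! (i - 1)"
      by (auto simp: qs nth_Cons')
    then show "chow_factor (\<rho> x (qs ! i) - \<rho> x ((x # qs) ! i)) =
        chow_factor (\<rho> y (qs ! i) - \<rho> y (qs ! (i - 1)))"
      by (simp add: nth)
  qed (simp add: qs)
  finally show ?thesis .
qed

lemma chow_poly_rec:
  assumes "x \<in> P"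
  shows "H x = 1 + (\<Sum>y\<in>above x. chow_factor (\<rho> x y) * H y)"
proof -
  define w where "w z ps = (\<Prod>i = 1..length ps - 1. chow_factor (\<rho> z (ps ! i) - \<rho> z (ps ! (i - 1))))"
    for z ps
  let ?C = "\<lambda>y. chains_from_to P r y b"
  have fin: "finite (?C y)" for y
    using finite by (rule finite_chains_from_to)
  have H: "H y = (\<Sum>ps\<in>?C y. w y ps)" for y
    by (simp add: chow_poly_def w_def)
  have hd: "qs \<noteq> [] \<and> hd qs = y" if "qs \<in> ?C y" for qs y
    using that by (simp add: chains_from_to_def)
  have "H x = w x [x] + (\<Sum>ps\<in>(\<Union>y\<in>above x. (#) x ` ?C y). w x ps)"
    unfolding H chains_eq[OF assms]
    \<comment> \<open>\<open>[x]\<close> lies outside the union because all tails there are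
      nonempty.\<close>
    by (rule sum.insert) (use fin hd in auto)
  also have "(\<Sum>ps\<in>(\<Union>y\<in>above x. (#) x ` ?C y). w x ps) =
      (\<Sum>y\<in>above x. \<Sum>ps\<in>(#) x ` ?C y. w x ps)"
    \<comment> \<open>The second entry of a chain determines \<open>y\<close>, hence
      disjointness.\<close>
    by (rule sum.UNION_disjoint) (use fin in \<open>auto dest: hd\<close>)
  also have "\<dots> = (\<Sum>y\<in>above x. \<Sum>qs\<in>?C y. w x (x # qs))"
    by (simp add: sum.reindex)
  also have "\<dots> = (\<Sum>y\<in>above x. \<Sum>qs\<in>?C y. chow_factor (\<rho> x y) * w y qs)"
    by (intro sum.cong refl) (use chain_weight_Cons[OF assms] in \<open>simp only: w_def\<close>)
  finally show ?thesis
    by (simp add: H w_def sum_distrib_left)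
qed

lemma chow_poly_top: "H b = 1"
proof -
  have "above b = {}"
    using top(2) po by (auto simp: above_def less_in_def partial_order_on_def dest: antisymD)
  then show ?thesis using chow_poly_rec[OF top(1)] by simp
qed

section \<open>Symmetry of the Chow polynomial\<close>

lemma symmetric_chow_poly: "x \<in> P \<Longrightarrow> symmetric_poly (\<rho> x b - 1) (H x)"
proof (induction "\<rho> x b" arbitrary: x rule: less_induct)
  case less
  show ?case
  proof (cases "x = b")
    case True
    \<comment> \<open>Truncated subtraction gives \<open>\<rho> b b - 1 = 0\<close>, which fits the
      constant polynomial 1.\<close>
    then show ?thesis by (simp add: chow_poly_top symmetric_poly_def rank_self top(1))
  next
    case False
    \<comment> \<open>The summand for \<open>b\<close> is the bare factor, with the wrong centre
      \<open>\<rho> x b\<close>/2; it is split off to be joined with the 1 of the recursion.\<close>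
    have b: "b \<in> above x"
      using False less.prems top by (simp add: above_def less_in_def)
    have "symmetric_poly (\<rho> x b - 1) (chow_factor (\<rho> x y) * H y)" if "y \<in> above x - {b}" for y
    proof -
      have y: "y \<in> P" "(x, y) \<in> r" "\<rho> x y > 0"
        using that rank_pos[OF less.prems] by (auto simp: above_def less_in_def)
      have "\<rho> x b = \<rho> x y + \<rho> y b"
        using rank_add[OF less.prems y(1) top(1) y(2) top(2)[OF y(1)]] .
      \<comment> \<open>Positivity keeps \<open>\<rho> y b - 1\<close> from truncating, so the two
        centres add up to (\<open>\<rho> x b\<close> - 1)/2.\<close>
      moreover have "\<rho> y b > 0"
        using that y(1) top rank_pos by (auto simp: less_in_def)
      ultimately show ?thesis
        using symmetric_poly_mult[OF symmetric_chow_factor[of "\<rho> x y"] less.hyps[OF _ y(1)]] y(3)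
        by simp
    qed
    then have "symmetric_poly (\<rho> x b - 1)
        ((1 + chow_factor (\<rho> x b)) + (\<Sum>y\<in>above x - {b}. chow_factor (\<rho> x y) * H y))"
      by (intro symmetric_poly_add symmetric_one_plus_chow_factor symmetric_poly_sum)
    then show ?thesis
      using chow_poly_rec[OF less.prems] sum.remove[OF finite_above b, of "\<lambda>y. chow_factor (\<rho> x y) * H y"]
      by (simp add: chow_poly_top add.assoc)
  qed
qed

section \<open>The three lowest coefficients and their inequalities\<close>

lemma coeff_chow_poly_0: "x \<in> P \<Longrightarrow> coeff (H x) 0 = 1"
  by (simp add: chow_poly_rec[of x] coeff_sum coeff_mult coeff_chow_factor)

lemma sum_above_eq_sum_above2:
  assumes "x \<in> P" "\<And>y. y \<in> P \<Longrightarrow> \<rho> x y < 2 \<Longrightarrow> g y = 0"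
  shows "sum g (above x) = sum g (above2 x)"
proof (rule sum.mono_neutral_right)
  show "above2 x \<subseteq> above x"
    using rank_pos[OF assms(1)] by (force simp: above_def above2_def)
  show "\<forall>y\<in>above x - above2 x. g y = 0"
    using assms(2) by (force simp: above_def above2_def)
qed simp

lemma coeff_chow_poly_1:
  assumes "x \<in> P"
  shows "coeff (H x) 1 = int (card (above2 x))"
proof -
  have "coeff (H x) 1 = (\<Sum>y\<in>above x. coeff (chow_factor (\<rho> x y) * H y) 1)"
    by (simp add: chow_poly_rec[OF assms] coeff_sum)
  also have "\<dots> = (\<Sum>y\<in>above2 x. coeff (chow_factor (\<rho> x y) * H y) 1)"
    by (rule sum_above_eq_sum_above2[OF assms]) (simp add: coeff_mult coeff_chow_factor)
  also have "\<dots> = (\<Sum>y\<in>above2 x. 1)"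
    by (intro sum.cong refl) (auto simp: above2_def coeff_mult coeff_chow_factor coeff_chow_poly_0)
  finally show ?thesis by simp
qed

text \<open>The t of a factor meets the linear coefficient of \<open>H y\<close>; its t^2, present
  from rank 3 on, meets the constant coefficient 1.\<close>

lemma coeff_chow_poly_2:
  assumes "x \<in> P"
  shows "coeff (H x) 2 = (\<Sum>y\<in>above2 x. int (card (above2 y)) + (if \<rho> x y \<ge> 3 then 1 else 0))"
proof -
  have [simp]: "{..2::nat} = {0, 1, 2}" by auto
  have "coeff (H x) 2 = (\<Sum>y\<in>above x. coeff (chow_factor (\<rho> x y) * H y) 2)"
    by (simp add: chow_poly_rec[OF assms] coeff_sum)
  also have "\<dots> = (\<Sum>y\<in>above2 x. coeff (chow_factor (\<rho> x y) * H y) 2)"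
    by (rule sum_above_eq_sum_above2[OF assms]) (simp add: coeff_mult coeff_chow_factor)
  also have "\<dots> = (\<Sum>y\<in>above2 x. int (card (above2 y)) + (if \<rho> x y \<ge> 3 then 1 else 0))"
    by (intro sum.cong refl)
      (auto simp: above2_def[of x] coeff_mult coeff_chow_factor coeff_chow_poly_0 coeff_chow_poly_1
        simp flip: One_nat_def)
  finally show ?thesis .
qed

text \<open>Additivity gives the inclusion, and \<open>y\<close> itself makes it strict.\<close>

lemma card_above2_less:
  assumes "x \<in> P" "y \<in> above2 x"
  shows "card (above2 y) < card (above2 x)"
proof (rule psubset_card_mono)
  have y: "y \<in> P" "\<rho> x y \<ge> 2" "(x, y) \<in> r"
    using assms rank_pos[OF assms(1), of y] by (auto simp: above2_def less_in_def)
  have "z \<in> above2 x" if "z \<in> above2 y" for z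
    using that y rank_pos[OF y(1), of z] rank_add[OF assms(1) y(1), of z]
    by (auto simp: above2_def less_in_def)
  moreover have "y \<notin> above2 y"
    using rank_self[OF y(1)] by (simp add: above2_def)
  ultimately show "above2 y \<subset> above2 x"
    using assms(2) by blast
qed simp

text \<open>Strictness in \<open>card_above2_less\<close> absorbs the extra 1, so each of the
  \<open>card (above2 x)\<close> summands is at most \<open>card (above2 x)\<close>.\<close>

lemma coeff_chow_poly_2_le:
  assumes "x \<in> P"
  shows "coeff (H x) 2 \<le> (coeff (H x) 1)\<^sup>2"
proof -
  have "coeff (H x) 2 \<le> (\<Sum>y\<in>above2 x. int (card (above2 x)))"
    unfolding coeff_chow_poly_2[OF assms]
    by (rule sum_mono) (use card_above2_less[OF assms] in force)
  also have "\<dots> = (coeff (H x) 1)\<^sup>2"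
    by (simp add: coeff_chow_poly_1[OF assms, unfolded One_nat_def] power2_eq_square)
  finally show ?thesis .
qed

text \<open>Each summand of the quadratic coefficient is at least 1: if
  \<open>\<rho> x y = 2\<close>, then \<open>\<rho> y b\<close> is at least 2, so \<open>b\<close>
  is counted in \<open>above2 y\<close>.\<close>

lemma coeff_chow_poly_1_le:
  assumes "x \<in> P" "\<rho> x b \<ge> 4"
  shows "coeff (H x) 1 \<le> coeff (H x) 2"
proof -
  have "1 \<le> int (card (above2 y)) + (if \<rho> x y \<ge> 3 then 1 else 0)" if "y \<in> above2 x" for y
  proof (cases "\<rho> x y \<ge> 3")
    case False
    have y: "y \<in> P" "\<rho> x y = 2" "(x, y) \<in> r"
      using that False rank_pos[OF assms(1), of y] by (auto simp: above2_def less_in_def)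
    then have "b \<in> above2 y"
      using rank_add[OF assms(1) y(1) top(1) y(3) top(2)] assms(2) top(1)
      by (simp add: above2_def)
    then have "card (above2 y) > 0"
      by (auto simp: card_gt_0_iff)
    then show ?thesis by simp
  qed simp
  from sum_mono[of "above2 x", OF this] show ?thesis
    by (simp add: coeff_chow_poly_1 coeff_chow_poly_2 assms(1) flip: One_nat_def)
qed

section \<open>Log-concavity up to weak rank 6\<close>

lemma log_concave_chow_poly:
  assumes x: "x \<in> P" and "\<rho> x b \<le> 6" and "1 \<le> i"
  shows "coeff (H x) (i - 1) * coeff (H x) (i + 1) \<le> (coeff (H x) i)\<^sup>2"
proof (cases "i + 1 \<le> \<rho> x b - 1")
  \<comment> \<open>Past the degree bound the product on the left vanishes.\<close>
  case False
  then have "coeff (H x) (i + 1) = 0"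
    using symmetric_chow_poly[OF x] by (intro coeff_eq_0) (auto simp: symmetric_poly_def)
  then show ?thesis by simp
next
  case True
  define h where "h = coeff (H x)"
  define d where "d = \<rho> x b"
  have sym: "h j = h (d - 1 - j)" if "j \<le> d - 1" for j
    using symmetric_chow_poly[OF x] that unfolding symmetric_poly_def h_def d_def by blast
  have h: "h 0 = 1" "h 1 \<ge> 0" "h 2 \<le> (h 1)\<^sup>2"
    using coeff_chow_poly_0[OF x] coeff_chow_poly_1[OF x] coeff_chow_poly_2_le[OF x]
    by (simp_all add: h_def)
  have h12: "h 1 \<le> h 2" if "d \<ge> 4"
    using coeff_chow_poly_1_le[OF x] that by (simp add: h_def d_def)
  have h12': "h 1 * h 1 \<le> (h 2)\<^sup>2" "h 1 * h 2 \<le> (h 2)\<^sup>2" if "d \<ge> 4"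
    using h(2) h12[OF that] by (auto simp: power2_eq_square intro!: mult_mono mult_right_mono)
  \<comment> \<open>By \<open>sym\<close> the coefficients are 1, h1, h1, 1 for d = 4; 1, h1, h2,
    h1, 1 for d = 5; and 1, h1, h2, h2, h1, 1 for d = 6. Each case with i > 1 is either the mirror
    image of i = 1 or one of the two bounds in \<open>h12'\<close>.\<close>
  have "i = 1 \<or> i = 2 \<and> d = 4 \<or> i = 2 \<and> d = 5 \<or> i = 2 \<and> d = 6
      \<or> i = 3 \<and> d = 5 \<or> i = 3 \<and> d = 6 \<or> i = 4 \<and> d = 6"
    using True assms(2,3) unfolding d_def[symmetric] by presburger
  then consider "i = 1" | "i = 2" "d = 4" | "i = 2" "d = 5" | "i = 2" "d = 6"
    | "i = 3" "d = 5" | "i = 3" "d = 6" | "i = 4" "d = 6"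
    by blast
  then have "h (i - 1) * h (i + 1) \<le> (h i)\<^sup>2"
  proof cases
    case 1
    then show ?thesis using h by (simp add: numeral_2_eq_2)
  next
    case 2
    then show ?thesis using h sym[of 2] sym[of 3] by simp
  next
    case 3
    then show ?thesis using h12' sym[of 3] by simp
  next
    case 4
    then show ?thesis using h12' sym[of 3] by simp
  next
    case 5
    then show ?thesis using h sym[of 3] sym[of 4] by simp
  next
    case 6
    then show ?thesis using h12' sym[of 3] sym[of 4] by (simp add: mult.commute)
  next
    case 7
    then show ?thesis using h sym[of 3] sym[of 4] sym[of 5] by simp
  qed
  then show ?thesis by (simp add: h_def)
qed

end

theorem theorem6p2:
  fixes P :: "'a set" and r :: "'a rel" and \<rho> :: "'a \<Rightarrow> 'a \<Rightarrow> nat" and a b :: 'a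
  assumes "finite P"
    and "partial_order_on P r"
    and "least_in P r a"
    and "greatest_in P r b"
    and "weak_rank_function P r \<rho>"
    and "\<rho> a b \<le> 6"
  shows "\<forall>i. 1 \<le> i \<and> i \<le> degree (chow_poly P r \<rho> a b) - 1 \<longrightarrow>
    (coeff (chow_poly P r \<rho> a b) i)\<^sup>2 \<ge>
      coeff (chow_poly P r \<rho> a b) (i - 1) * coeff (chow_poly P r \<rho> a b) (i + 1)"
proof -
  interpret weakly_ranked_poset P r \<rho> b
    using assms by unfold_locales
  have "a \<in> P"
    using assms(3) by (simp add: least_in_def)
  with log_concave_chow_poly assms(6) show ?thesis
    by blast
qed

end
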